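(* Let $(\alpha_n,\beta_n)_{n\in\mathbb{Z}}$ be a bilateral Bailey pair relative to $a$, and let $b_1,b_2,\dots$ be complex parameters different from $1$. For all $N\geq 1$, define \[ \alpha^{(N)}_n=\frac{(1-aq^{2n-N})(aq^{1-N})_N}{(1-b_1)\cdots(1-b_N)}\sum_{j\in\mathbb{Z}}(-1)^j\frac{q^{jn-j(j+1)/2}f_{N,j,n}(b_1,\ldots,b_N)}{(aq^{2n-N-j})_{N+1}}\alpha_{n-j}, \] where \[ f_{N,j,n}(b_1,\ldots,b_N)=\sum_{M\in\mathbb{Z}}\sum_{u\in\mathbb{Z}}a^{u}q^{(M-j+u)(n-j+u)+u(n-N)}\begin{bmatrix}M\\ j-u\end{bmatrix}\begin{bmatrix}N-M\\ u\end{bmatrix}(-1)^Me_M(b_1,\dots,b_N), \] and \[ \beta^{(N)}_n=\left(\prod_{i=1}^N\frac{1-b_iq^n}{1-b_i}\right)\beta_n . \] Then $(\alpha^{(N)}_n,\beta^{(N)}_n)$ is a bilateral Bailey pair relative to $aq^{-N}$.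
   Context: Fix complex numbers $a,q$ with $|q|<1$ (parameters generic so that no denominator vanishes). For complex $x$, $(x)_\infty=\prod_{j\ge0}(1-xq^j)$ and for $k\in\mathbb{Z}$, $(x)_k=(x)_\infty/(xq^k)_\infty$ (so $1/(q)_k=0$ for $k<0$). A bilateral Bailey pair relative to $c$ is a pair of sequences $(\alpha_n)_{n\in\mathbb{Z}},(\beta_n)_{n\in\mathbb{Z}}$ such that for every $n\in\mathbb{Z}$, $\beta_n=\sum_{j\le n}\frac{\alpha_j}{(q)_{n-j}(cq)_{n+j}}$ (the series being convergent). For $0\le M\le N$, $e_M(X_1,\dots,X_N)=\sum_{1\le i_1<\dots<i_M\le N}X_{i_1}\cdots X_{i_M}$ is the elementary symmetric polynomial, and $e_M=0$ if $M<0$ or $M>N$ (terms of $f$ with such $M$ are zero). For integers $N\ge0$ and $j$, the $q$-binomial coefficient is $\begin{bmatrix}N\\ j\end{bmatrix}=\frac{(q)_N}{(q)_j(q)_{N-j}}$ for $0\le j\le N$ and $0$ otherwise. (Consequently $f_{N,j,n}=0$ unless $0\le j\le N$, so the sum over $j$ is finite.) *)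

theory Defs
  imports "HOL-Analysis.Analysis"
begin

definition qpoch_inf :: "complex \<Rightarrow> complex \<Rightarrow> complex" where
  "qpoch_inf q x = (\<Prod>j. 1 - x * q ^ j)"

definition qpoch :: "complex \<Rightarrow> complex \<Rightarrow> int \<Rightarrow> complex" where
  "qpoch q x k = qpoch_inf q x / qpoch_inf q (x * q powi k)"

text \<open>The series over the integers \<open>j \<le> n\<close> is summed in the order \<open>j = n, n - 1, n - 2, \<dots>\<close>;
  as usual for a convergent series, absolute convergence is not required.\<close>

definition bilateral_bailey_pair ::
    "complex \<Rightarrow> complex \<Rightarrow> (int \<Rightarrow> complex) \<Rightarrow> (int \<Rightarrow> complex) \<Rightarrow> bool" where
  "bilateral_bailey_pair q c \<alpha> \<beta> \<longleftrightarrow>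
     (\<forall>n. (\<lambda>k::nat. let j = n - int k in
              \<alpha> j / (qpoch q q (n - j) * qpoch q (c * q) (n + j))) sums \<beta> n)"

text \<open>The sum is empty, hence zero, for \<open>M < 0\<close> and for \<open>M > N\<close>.\<close>

definition elem_sym :: "nat \<Rightarrow> int \<Rightarrow> (nat \<Rightarrow> complex) \<Rightarrow> complex" where
  "elem_sym N M x = (\<Sum>I | I \<subseteq> {1..N} \<and> int (card I) = M. \<Prod>i\<in>I. x i)"

definition qbinom :: "complex \<Rightarrow> int \<Rightarrow> int \<Rightarrow> complex" where
  "qbinom q N j =
     (if 0 \<le> j \<and> j \<le> N then qpoch q q N / (qpoch q q j * qpoch q q (N - j)) else 0)"

text \<open>The infinite sums below, over all integers, have only finitely many nonzero terms.\<close>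

definition bailey_f ::
    "complex \<Rightarrow> complex \<Rightarrow> (nat \<Rightarrow> complex) \<Rightarrow> nat \<Rightarrow> int \<Rightarrow> int \<Rightarrow> complex" where
  "bailey_f q a b N j n =
     (\<Sum>\<^sub>\<infinity>M::int. \<Sum>\<^sub>\<infinity>u::int.
        a powi u * q powi ((M - j + u) * (n - j + u) + u * (n - int N))
        * qbinom q M (j - u) * qbinom q (int N - M) u * (-1) powi M * elem_sym N M b)"

definition bailey_alpha ::
    "complex \<Rightarrow> complex \<Rightarrow> (nat \<Rightarrow> complex) \<Rightarrow> (int \<Rightarrow> complex) \<Rightarrow> nat \<Rightarrow> int \<Rightarrow> complex" where
  "bailey_alpha q a b \<alpha> N n =
     (1 - a * q powi (2 * n - int N)) * qpoch q (a * q powi (1 - int N)) (int N)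
       / (\<Prod>i=1..N. 1 - b i)
     * (\<Sum>\<^sub>\<infinity>j::int. (-1) powi j
          * (q powi (j * n - (j * (j + 1)) div 2) * bailey_f q a b N j n
             / qpoch q (a * q powi (2 * n - int N - j)) (int N + 1))
          * \<alpha> (n - j))"

definition bailey_beta ::
    "complex \<Rightarrow> (nat \<Rightarrow> complex) \<Rightarrow> (int \<Rightarrow> complex) \<Rightarrow> nat \<Rightarrow> int \<Rightarrow> complex" where
  "bailey_beta q b \<beta> N n = (\<Prod>i=1..N. (1 - b i * q powi n) / (1 - b i)) * \<beta> n"

end

theory Submission
  imports Defs
begin

text \<open>
  Induction on \<open>N\<close>, one parameter \<open>b\<close> at a time. In the single step from \<open>c\<close> to \<open>c/q\<close>, the
  \<open>k\<close>-th term of the new series is \<open>(1 - b q\<^sup>n)/(1 - b) t\<^sub>k + w\<^sub>k t\<^sub>k - w\<^sub>k\<^sub>+\<^sub>1 t\<^sub>k\<^sub>+\<^sub>1\<close>, where \<open>t\<^sub>k\<close> is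
  the old term and \<open>w\<close> converges with \<open>w\<^sub>0 = 0\<close>; so the correction telescopes to zero even if the
  series converges only conditionally. That iterating the single step gives the stated \<open>\<alpha>\<^sup>(\<^sup>N\<^sup>)\<close>
  amounts to a three-term recurrence of \<open>f\<close> in \<open>N\<close>. Its coefficients of \<open>e\<^sub>M\<close> are sums over \<open>u\<close> whose
  defect also telescopes, by the two \<open>q\<close>-Pascal rules.
\<close>

section \<open>Infinite products and q-shifted factorials\<close>

lemma qpoch_inf_convergent:
  fixes q x :: complex
  assumes "norm q < 1"
  shows "convergent_prod (\<lambda>j. 1 - x * q ^ j)"
proof -
  have "summable (\<lambda>j. norm x * norm q ^ j)"
    using assms by (intro summable_mult summable_geometric) simp
  hence "abs_convergent_prod (\<lambda>j. 1 - x * q ^ j)"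
    unfolding abs_convergent_prod_conv_summable by (simp add: norm_mult norm_power)
  thus ?thesis by (rule abs_convergent_prod_imp_convergent_prod)
qed

lemma qpoch_inf_nonzero:
  assumes "norm q < 1" "\<And>j::nat. x * q ^ j \<noteq> 1"
  shows "qpoch_inf q x \<noteq> 0"
proof -
  have "1 - x * q ^ j \<noteq> 0" for j
    using assms(2)[of j] by (metis right_minus_eq)
  thus ?thesis
    unfolding qpoch_inf_def by (rule prodinf_nonzero[OF qpoch_inf_convergent[OF assms(1)]])
qed

lemma qpoch_inf_rec:
  assumes "norm q < 1" "x \<noteq> 1"
  shows "qpoch_inf q x = (1 - x) * qpoch_inf q (x * q)"
  using prodinf_split_head[OF qpoch_inf_convergent[OF assms(1), of x]] assms(2)
  unfolding qpoch_inf_def by (simp add: mult_ac)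

lemma qpoch_inf_powi_nonzero:
  assumes "norm q < 1" "q \<noteq> 0" "\<And>k::int. x * q powi k \<noteq> 1"
  shows "qpoch_inf q (x * q powi m) \<noteq> 0"
  using qpoch_inf_nonzero[OF assms(1), of "x * q powi m"] assms(3)[of "m + int j" for j] assms(2)
  by (auto simp: power_int_add mult.assoc)

lemma qpoch_inf_powi_rec:
  assumes "norm q < 1" "q \<noteq> 0" "\<And>k::int. x * q powi k \<noteq> 1"
  shows "qpoch_inf q (x * q powi m) = (1 - x * q powi m) * qpoch_inf q (x * q powi (m + 1))"
  using qpoch_inf_rec[OF assms(1,3)] assms(2) by (simp add: power_int_add mult.assoc)

text \<open>Base \<open>q\<close> is not generic: \<open>q * q powi k = 1\<close> at
  \<open>k = -1\<close>, so \<open>qpoch_inf_powi_rec\<close> does not apply to it. For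
  \<open>k \<ge> 0\<close> only positive powers of \<open>q\<close> occur, and their norm is below
  1.\<close>

lemma qpoch_q_rec:
  assumes "norm q < 1" "q \<noteq> 0" "k \<ge> 0"
  shows "qpoch q q (k + 1) = (1 - q powi (k + 1)) * qpoch q q k"
    and "qpoch q q k \<noteq> 0"
    and "q powi (k + 1) \<noteq> 1"
proof -
  have pow: "q ^ Suc m \<noteq> 1" for m
  proof
    assume "q ^ Suc m = 1"
    hence "norm q ^ Suc m = 1" by (metis norm_one norm_power)
    moreover have "norm q ^ Suc m < 1" using assms(1,2) by (intro power_Suc_less_one) auto
    ultimately show False by simp
  qed
  have nz: "qpoch_inf q (q ^ Suc m) \<noteq> 0" for m
    using pow[of "m + j" for j] assms(1)
    by (intro qpoch_inf_nonzero) (auto simp: power_add mult_ac)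
  obtain m where k: "k = int m" using assms(3) nonneg_int_cases by blast
  have p: "q * q powi int i = q ^ Suc i" for i by (simp add: power_int_def)
  have p': "q powi (int i + 1) = q ^ Suc i" for i
    by (metis add.commute of_nat_Suc power_int_of_nat)
  show "q powi (k + 1) \<noteq> 1" using pow[of m] unfolding k p' .
  show "qpoch q q k \<noteq> 0"
    using nz[of 0] nz[of m] by (simp add: qpoch_def k)
  have "qpoch_inf q (q ^ Suc m) = (1 - q ^ Suc m) * qpoch_inf q (q ^ Suc (Suc m))"
    using qpoch_inf_rec[OF assms(1) pow[of m]] by (simp add: mult_ac)
  moreover have "k + 1 = int (Suc m)" by (simp add: k)
  ultimately show "qpoch q q (k + 1) = (1 - q powi (k + 1)) * qpoch q q k"
    unfolding qpoch_def k using nz[of m] nz[of "Suc m"] p' p p[of "Suc m"]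
    by (auto simp: divide_simps)
qed

lemma qpoch_q_0:
  assumes "norm q < 1" "q \<noteq> 0"
  shows "qpoch q q 0 = 1"
  using qpoch_q_rec(2)[OF assms, of 0] by (auto simp: qpoch_def)

section \<open>q-binomial coefficients\<close>

lemma qbinom_eq_0: "j < 0 \<or> N < j \<Longrightarrow> qbinom q N j = 0"
  by (auto simp: qbinom_def)

text \<open>For \<open>0 \<le> v < M\<close> both sides are
  \<open>(q)_M / ((q)_v (q)_(M-v-1))\<close>. At \<open>v = -1\<close> and \<open>v = M\<close> a
  factor \<open>1 - q powi 0\<close> on one side meets a vanishing binomial on the other, so no
  range has to be assumed.\<close>

lemma qbinom_absorb:
  assumes "norm q < 1" "q \<noteq> 0"
  shows "(1 - q powi (v + 1)) * qbinom q M (v + 1) = (1 - q powi (M - v)) * qbinom q M v"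
proof -
  consider "v < -1" | "v = -1" | "v \<ge> 0" "v < M" | "v = M" | "v > M" by linarith
  thus ?thesis
  proof cases
    case 3
    note r = qpoch_q_rec[OF assms]
    have "M - v - 1 \<ge> 0" "M \<ge> 0" using 3 by auto
    hence "qpoch q q (v + 1) = (1 - q powi (v + 1)) * qpoch q q v"
      "qpoch q q (M - v) = (1 - q powi (M - v)) * qpoch q q (M - (v + 1))"
      "q powi (v + 1) \<noteq> 1" "q powi (M - v) \<noteq> 1"
      using 3 r(1)[of v] r(1)[of "M - v - 1"] r(3)[of v] r(3)[of "M - v - 1"]
      by (simp_all add: diff_diff_eq)
    thus ?thesis using 3 by (simp add: qbinom_def)
  qed (auto simp: qbinom_def)
qed

text \<open>With \<open>x = q powi u\<close>, \<open>y = q powi (K + 1 - u)\<close> and a common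
  factor \<open>A\<close>, the two rules are \<open>1 - x * y = x * (1 - y) + (1 - x)\<close> and
  \<open>1 - x * y = (1 - y) + y * (1 - x)\<close>. They fail at \<open>K = -1\<close>,
  \<open>u = 0\<close>, where the left side is 1 and the right side 0.\<close>

lemma qbinom_pascal:
  assumes "norm q < 1" "q \<noteq> 0" "K \<ge> 0"
  shows "qbinom q (K + 1) u = q powi u * qbinom q K u + qbinom q K (u - 1)"
    and "qbinom q (K + 1) u = qbinom q K u + q powi (K + 1 - u) * qbinom q K (u - 1)"
proof -
  note r = qpoch_q_rec[OF assms(1,2)]
  have "qbinom q (K + 1) u = q powi u * qbinom q K u + qbinom q K (u - 1) \<and>
    qbinom q (K + 1) u = qbinom q K u + q powi (K + 1 - u) * qbinom q K (u - 1)"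
  proof -
    consider "u < 0" | "u = 0" | "u > 0" "u \<le> K" | "u = K + 1" | "u > K + 1" by linarith
    thus ?thesis
    proof cases
      case 3
      define A where "A = qpoch q q K / (qpoch q q u * qpoch q q (K + 1 - u))"
      define x where "x = q powi u"
      define y where "y = q powi (K + 1 - u)"
      have xy: "q powi (K + 1) = x * y"
        using assms(2) by (simp add: x_def y_def flip: power_int_add)
      have "qbinom q (K + 1) u = (1 - x * y) * A"
        using 3 r(1)[of K] by (simp add: qbinom_def A_def xy)
      moreover have "qbinom q K u = (1 - y) * A"
        using 3 r(1)[of "K - u"] r(3)[of "K - u"]
        by (simp add: qbinom_def A_def y_def add_diff_eq diff_add_eq)
      moreover have "qbinom q K (u - 1) = (1 - x) * A"
        using 3 r(1)[of "u - 1"] r(3)[of "u - 1"]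
        by (simp add: qbinom_def A_def x_def diff_diff_eq2)
      ultimately show ?thesis by (simp flip: x_def y_def add: ring_distribs mult_ac)
    qed (use r(2) assms(3) in \<open>auto simp: qbinom_def qpoch_q_0[OF assms(1,2)]\<close>)
  qed
  thus "qbinom q (K + 1) u = q powi u * qbinom q K u + qbinom q K (u - 1)"
    "qbinom q (K + 1) u = qbinom q K u + q powi (K + 1 - u) * qbinom q K (u - 1)"
    by auto
qed

section \<open>Elementary symmetric polynomials\<close>

lemma elem_sym_eq_0: "M < 0 \<or> M > int N \<Longrightarrow> elem_sym N M b = 0"
proof -
  assume M: "M < 0 \<or> M > int N"
  have le: "card I \<le> N" if "I \<subseteq> {1..N}" for I
    using card_mono[OF finite_atLeastAtMost that] by simp
  have "int (card I) \<noteq> M" if "I \<subseteq> {1..N}" for I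
    using le[OF that] M by linarith
  hence "{I. I \<subseteq> {1..N} \<and> int (card I) = M} = {}"
    by blast
  thus ?thesis by (simp only: elem_sym_def sum.empty)
qed

text \<open>The index sets are split according to whether they contain \<open>Suc N\<close>.\<close>

lemma elem_sym_Suc:
  "elem_sym (Suc N) M b = elem_sym N M b + b (Suc N) * elem_sym N (M - 1) b"
proof -
  let ?S = "\<lambda>N M. {I. I \<subseteq> {1..N} \<and> int (card I) = M}"
  have fin: "finite I" if "I \<subseteq> {1..N}" for I using that finite_subset by blast
  have notin: "Suc N \<notin> I" if "I \<subseteq> {1..N}" for I using that by auto
  have S: "?S (Suc N) M = ?S N M \<union> insert (Suc N) ` ?S N (M - 1)"
  proof (intro equalityI subsetI)
    fix I assume I: "I \<in> ?S (Suc N) M"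
    show "I \<in> ?S N M \<union> insert (Suc N) ` ?S N (M - 1)"
    proof (cases "Suc N \<in> I")
      case True
      have "finite I" using I finite_subset by blast
      hence "int (card (I - {Suc N})) = M - 1"
        using I True card_Suc_Diff1[of I "Suc N"] by auto
      moreover have "I - {Suc N} \<subseteq> {1..N}" using I by (auto simp: le_Suc_eq)
      moreover have "I = insert (Suc N) (I - {Suc N})" using True by auto
      ultimately show ?thesis by blast
    next
      case False
      hence "I \<subseteq> {1..N}" using I by (auto simp: le_Suc_eq)
      thus ?thesis using I by auto
    qed
  next
    fix I assume "I \<in> ?S N M \<union> insert (Suc N) ` ?S N (M - 1)"
    thus "I \<in> ?S (Suc N) M" using fin notin by (auto simp: card_insert_if)
  qed
  have "inj_on (insert (Suc N)) (?S N (M - 1))"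
    by (rule inj_onI) (metis (no_types, lifting) insert_ident mem_Collect_eq notin)
  moreover have "(\<Prod>i\<in>insert (Suc N) I. b i) = b (Suc N) * (\<Prod>i\<in>I. b i)" if "I \<in> ?S N (M - 1)" for I
    using that fin notin by auto
  moreover have "?S N M \<inter> insert (Suc N) ` ?S N (M - 1) = {}" by auto
  moreover have "finite (?S N M)" for M by simp
  ultimately show ?thesis
    unfolding elem_sym_def S
    by (subst sum.union_disjoint) (auto simp: sum.reindex sum_distrib_left)
qed


section \<open>Recurrences for the summand of f\<close>

text \<open>The summand of \<open>f\<close> without \<open>a\<^sup>u\<close> and \<open>e\<^sub>M\<close>, in the coordinates \<open>v = j - u\<close> and \<open>K = N - M\<close>,
  in which the recurrences do not mention \<open>j\<close> and \<open>N\<close>.\<close>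

definition gterm :: "complex \<Rightarrow> int \<Rightarrow> int \<Rightarrow> int \<Rightarrow> int \<Rightarrow> int \<Rightarrow> complex" where
  "gterm q n M K v u =
     q powi ((M - v) * (n - v) + u * (n - M - K)) * qbinom q M v * qbinom q K u"

context
  fixes q :: complex
  assumes q: "norm q < 1" "q \<noteq> 0"
begin

text \<open>Serves to pull one power \<open>q powi c\<close> out of every term of a recurrence. What
  remains, \<open>q powi d\<close> times two binomials, is in reach of the q-Pascal rules; the
  assumption is a polynomial identity between exponents.\<close>

lemma gterm_scaled:
  assumes "e + (M - v) * (n - v) + u * (n - M - K) = c + d"
  shows "q powi e * gterm q n M K v u = q powi c * q powi d * (qbinom q M v * qbinom q K u)"
proof -
  have "q powi e * gterm q n M K v u =
      q powi (e + (M - v) * (n - v) + u * (n - M - K)) * (qbinom q M v * qbinom q K u)"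
    unfolding gterm_def using q(2) by (simp add: power_int_add)
  thus ?thesis unfolding assms using q(2) by (simp add: power_int_add)
qed

lemmas gterm_eq = gterm_scaled[of 0, simplified]

text \<open>The telescoping quantities: by the lemmas below, the \<open>u\<close>-th defect is the value at
  \<open>(v, u)\<close> minus \<open>a\<close> times the value at \<open>(v - 1, u + 1)\<close>.\<close>

definition shiftA where
  "shiftA n M K v u = q powi ((M - v) * (n - v) + u * (n - M - K - 1)) *
     qbinom q M v * qbinom q K (u - 1) * (1 - q powi (v - M))"

text \<open>This is the part free of \<open>a\<close> in the defect of \<open>gsum_rec_A\<close>.
  The first q-Pascal rule for \<open>qbinom q (K + 1) u\<close> cancels
  \<open>gterm q n M K v u\<close> entirely and leaves a multiple of
  \<open>qbinom q K (u - 1)\<close>.\<close>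

lemma gterm_rec_A1:
  assumes "K \<ge> 0"
  shows "gterm q n M (K + 1) v u - gterm q n M K v u
    - q powi (n - 1 - M - K) * gterm q (n - 1) M K v (u - 1) = shiftA n M K v u"
proof -
  define c where "c = (M - v) * (n - v) + u * (n - M - K - 1)"
  have e1: "gterm q n M (K + 1) v u = q powi c * q powi 0 * (qbinom q M v * qbinom q (K + 1) u)"
    by (rule gterm_eq) (simp add: c_def algebra_simps)
  have e2: "gterm q n M K v u = q powi c * q powi u * (qbinom q M v * qbinom q K u)"
    by (rule gterm_eq) (simp add: c_def algebra_simps)
  have e3: "q powi (n - 1 - M - K) * gterm q (n - 1) M K v (u - 1) =
      q powi c * q powi (v - M) * (qbinom q M v * qbinom q K (u - 1))"
    by (rule gterm_scaled) (simp add: c_def algebra_simps)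
  show ?thesis
    unfolding shiftA_def c_def[symmetric]
    by (simp only: qbinom_pascal(1)[OF q assms] e1 e2 e3 power_int_0_right) (simp add: algebra_simps)
qed

text \<open>The coefficient of \<open>-a\<close> in the same defect. Now the second q-Pascal rule
  cancels the \<open>u - 1\<close> term; \<open>qbinom_absorb\<close> rewrites the rest as a shifted
  \<open>shiftA\<close>.\<close>

lemma gterm_rec_A2:
  assumes "K \<ge> 0"
  shows "q powi (2 * n - M - K - 1) * gterm q n M (K + 1) v u
    - q powi (2 * n - M - K - 1 - u - v) * gterm q n M K v u
    - q powi (3 * n - 1 - M - K - u - v) * gterm q (n - 1) M K v (u - 1)
    = shiftA n M K (v - 1) (u + 1)"
proof -
  define c where "c = (M - v) * (n - v) + u * (n - M - K - 1) + 2 * n - M - K - 1 - v"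
  have e1: "q powi (2 * n - M - K - 1) * gterm q n M (K + 1) v u =
      q powi c * q powi v * (qbinom q M v * qbinom q (K + 1) u)"
    by (rule gterm_scaled) (simp add: c_def algebra_simps)
  have e2: "q powi (2 * n - M - K - 1 - u - v) * gterm q n M K v u =
      q powi c * q powi 0 * (qbinom q M v * qbinom q K u)"
    by (rule gterm_scaled) (simp add: c_def algebra_simps)
  have e3: "q powi (3 * n - 1 - M - K - u - v) * gterm q (n - 1) M K v (u - 1) =
      q powi c * q powi (v + (K + 1 - u)) * (qbinom q M v * qbinom q K (u - 1))"
    by (rule gterm_scaled) (simp add: c_def algebra_simps)
  have e4: "q powi (v + (K + 1 - u)) = q powi v * q powi (K + 1 - u)"
    using q(2) by (simp add: power_int_add)
  have absorb: "(1 - q powi v) * qbinom q M v = (1 - q powi (M - v + 1)) * qbinom q M (v - 1)"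
    using qbinom_absorb[OF q, of "v - 1" M] by (simp add: algebra_simps)
  have e6: "shiftA n M K (v - 1) (u + 1) =
      - (q powi c * ((1 - q powi v) * qbinom q M v) * qbinom q K u)"
  proof -
    have "q powi ((M - (v - 1)) * (n - (v - 1)) + (u + 1) * (n - M - K - 1)) =
        q powi c * q powi (M - v + 1)"
      using q(2) by (simp add: c_def algebra_simps flip: power_int_add)
    moreover have "q powi (M - v + 1) * q powi (v - 1 - M) = 1"
      using q(2) by (simp flip: power_int_add)
    ultimately have "shiftA n M K (v - 1) (u + 1) =
        q powi c * qbinom q M (v - 1) * qbinom q K u * (q powi (M - v + 1) - 1)"
      unfolding shiftA_def by (simp add: right_diff_distrib)
    thus ?thesis unfolding absorb by (simp add: algebra_simps)
  qed
  show ?thesis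
    by (simp only: qbinom_pascal(2)[OF q assms] e1 e2 e3 e4 e6 power_int_0_right) (simp add: algebra_simps)
qed

definition shiftB where
  "shiftB n M K v u = q powi ((M + 1 - v) * (n - v) + u * (n - M - K - 1) + v) *
     qbinom q M v * qbinom q K u * (1 - q powi u)"

text \<open>The part free of \<open>a\<close> in the defect of \<open>gsum_rec_B\<close>: here
  \<open>M\<close> grows while \<open>K\<close> is fixed, so the first q-Pascal rule acts on
  \<open>qbinom q (M + 1) v\<close>.\<close>

lemma gterm_rec_B1:
  assumes "M \<ge> 0"
  shows "gterm q n (M + 1) K v u - q powi n * gterm q n M K v u
    - gterm q (n - 1) M K (v - 1) u = shiftB n M K v u"
proof -
  define c where "c = (M + 1 - v) * (n - v) + u * (n - M - K - 1)"
  have e1: "gterm q n (M + 1) K v u = q powi c * q powi 0 * (qbinom q (M + 1) v * qbinom q K u)"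
    by (rule gterm_eq) (simp add: c_def algebra_simps)
  have e2: "q powi n * gterm q n M K v u =
      q powi c * q powi (v + u) * (qbinom q M v * qbinom q K u)"
    by (rule gterm_scaled) (simp add: c_def algebra_simps)
  have e3: "gterm q (n - 1) M K (v - 1) u =
      q powi c * q powi 0 * (qbinom q M (v - 1) * qbinom q K u)"
    by (rule gterm_eq) (simp add: c_def algebra_simps)
  have e4: "q powi (v + u) = q powi v * q powi u" "q powi (c + v) = q powi c * q powi v"
    using q(2) by (simp_all add: power_int_add)
  show ?thesis
    unfolding shiftB_def c_def[symmetric]
    by (simp only: qbinom_pascal(1)[OF q assms] e1 e2 e3 e4 power_int_0_right) (simp add: algebra_simps)
qed

text \<open>The coefficient of \<open>-a\<close>: the second q-Pascal rule leaves
  \<open>(1 - q powi (K - u)) * qbinom q K u\<close>, which absorption moves to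
  \<open>u + 1\<close>.\<close>

lemma gterm_rec_B2:
  assumes "M \<ge> 0"
  shows "q powi (2 * n - M - K - 1) * gterm q n (M + 1) K v u
    - q powi (3 * n - M - K - 1 - u - v) * gterm q n M K v u
    - q powi (2 * n - u - v) * gterm q (n - 1) M K (v - 1) u
    = shiftB n M K (v - 1) (u + 1)"
proof -
  define c where "c = (M + 1 - v) * (n - v) + u * (n - M - K - 1) + 2 * n - M - K - 1"
  have e1: "q powi (2 * n - M - K - 1) * gterm q n (M + 1) K v u =
      q powi c * q powi 0 * (qbinom q (M + 1) v * qbinom q K u)"
    by (rule gterm_scaled) (simp add: c_def algebra_simps)
  have e2: "q powi (3 * n - M - K - 1 - u - v) * gterm q n M K v u =
      q powi c * q powi 0 * (qbinom q M v * qbinom q K u)"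
    by (rule gterm_scaled) (simp add: c_def algebra_simps)
  have e3: "q powi (2 * n - u - v) * gterm q (n - 1) M K (v - 1) u =
      q powi c * q powi (M + 1 - v + (K - u)) * (qbinom q M (v - 1) * qbinom q K u)"
    by (rule gterm_scaled) (simp add: c_def algebra_simps)
  have e4: "q powi (M + 1 - v + (K - u)) = q powi (M + 1 - v) * q powi (K - u)"
    using q(2) by (simp add: power_int_add)
  have e5: "shiftB n M K (v - 1) (u + 1) =
      q powi c * q powi (M + 1 - v) * ((1 - q powi (K - u)) * qbinom q K u) * qbinom q M (v - 1)"
  proof -
    have "q powi ((M + 1 - (v - 1)) * (n - (v - 1)) + (u + 1) * (n - M - K - 1) + (v - 1)) =
        q powi c * q powi (M + 1 - v)"
      using q(2) by (simp add: c_def algebra_simps flip: power_int_add)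
    thus ?thesis unfolding shiftB_def qbinom_absorb[OF q, symmetric] by simp
  qed
  show ?thesis
    by (simp only: qbinom_pascal(2)[OF q assms] e1 e2 e3 e4 e5 power_int_0_right) (simp add: algebra_simps)
qed

end

section \<open>The single step from c to c/q\<close>

lemma bailey_step:
  fixes q c b :: complex and \<alpha> \<beta> :: "int \<Rightarrow> complex"
  assumes q: "norm q < 1" "q \<noteq> 0" and c: "c \<noteq> 0" "\<And>k::int. c * q powi k \<noteq> 1" and b: "b \<noteq> 1"
    and bp: "bilateral_bailey_pair q c \<alpha> \<beta>"
  shows "bilateral_bailey_pair q (c * q powi (-1))
    (\<lambda>n. (1 - c) / (1 - b) * ((1 - b * q powi n) / (1 - c * q powi (2 * n)) * \<alpha> n
       - q powi (n - 1) * (c * q powi (n - 1) - b) / (1 - c * q powi (2 * (n - 1))) * \<alpha> (n - 1)))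
    (\<lambda>n. (1 - b * q powi n) / (1 - b) * \<beta> n)"
proof -
  define P where "P m = qpoch_inf q (c * q powi m)" for m
  note P_nz = qpoch_inf_powi_nonzero[OF q c(2), folded P_def]
  note P_rec = qpoch_inf_powi_rec[OF q c(2), folded P_def]
  have cnz: "1 - c * q powi k \<noteq> 0" for k using c(2)[of k] by (metis right_minus_eq)
  have qpoch_cq: "qpoch q (c * q) m = P 1 / P (m + 1)" for m
    using q by (simp add: qpoch_def P_def power_int_add mult_ac)
  have qpoch_c: "qpoch q (c * q powi (-1) * q) m = P 0 / P m" for m
  proof -
    have "c * q powi (-1) * q = c" using q by simp
    show ?thesis unfolding qpoch_def P_def \<open>c * q powi (-1) * q = c\<close> by simp
  qed
  show ?thesis unfolding bilateral_bailey_pair_def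
  proof (intro allI)
    fix n
    define j where "j k = n - int k" for k
    define t where "t k = \<alpha> (j k) / (qpoch q q (int k) * (P 1 / P (2 * n - int k + 1)))" for k
    \<comment> \<open>\<open>w k\<close> is the excess over \<open>S\<close> in the ratio of the new
      coefficient of \<open>\<alpha> (j k)\<close> to the old one. Its factor
      \<open>1 - q ^ k\<close> gives \<open>w 0 = 0\<close>, and at \<open>Suc k\<close> it cancels
      the last factor of \<open>(q)_(k+1)\<close> in \<open>t (Suc k)\<close>.\<close>
    define w where "w k = (1 - q ^ k) * (q powi j k * (c * q powi j k - b)) /
        ((1 - b) * (1 - c * q powi (2 * j k)))" for k
    define S where "S = (1 - b * q powi n) / (1 - b)"
    have t: "t sums \<beta> n"
      using bp[unfolded bilateral_bailey_pair_def, rule_format, of n]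
      by (simp add: Let_def qpoch_cq t_def[abs_def] j_def algebra_simps)
    \<comment> \<open>With \<open>z = q\<^bsup>k-n\<^esup> \<rightarrow> 0\<close> both large powers of \<open>1/q\<close> cancel.\<close>
    have w_lim: "w \<longlonglongrightarrow> (1 - 0) * ((c - b * (0 * q powi (-n))) / ((1 - b) * ((0 * q powi (-n))\<^sup>2 - c)))"
    proof -
      define z where "z k = q ^ k * q powi (-n)" for k
      have w_eq: "w k = (1 - q ^ k) * ((c - b * z k) / ((1 - b) * ((z k)\<^sup>2 - c)))" for k
      proof -
        have z: "z k \<noteq> 0" "q powi j k = 1 / z k"
          using q by (simp_all add: z_def j_def power_int_diff power_int_minus field_simps)
        have z2: "q powi (2 * j k) = 1 / (z k)\<^sup>2"
          using q power_int_add[of q "j k" "j k"] by (simp add: z(2) power2_eq_square)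
        have "(z k)\<^sup>2 \<noteq> c" using cnz[of "2 * j k"] z by (auto simp: z2)
        thus ?thesis using z b cnz[of "2 * j k"]
          unfolding w_def z2 z(2) by (simp add: divide_simps power2_eq_square)
      qed
      have "(\<lambda>k. (1 - q ^ k) * ((c - b * z k) / ((1 - b) * ((z k)\<^sup>2 - c)))) \<longlonglongrightarrow>
          (1 - 0) * ((c - b * (0 * q powi (-n))) / ((1 - b) * ((0 * q powi (-n))\<^sup>2 - c)))"
        unfolding z_def using c(1) b q by (intro tendsto_intros LIMSEQ_power_zero) auto
      thus ?thesis unfolding w_eq[symmetric] .
    qed
    have "(\<lambda>k. w k * t k) \<longlonglongrightarrow> 0"
      using tendsto_mult[OF w_lim summable_LIMSEQ_zero[OF sums_summable[OF t]]] by simp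
    from telescope_sums'[OF this] have "(\<lambda>k. w k * t k - w (Suc k) * t (Suc k)) sums 0"
      by (simp add: w_def)
    from sums_add[OF sums_mult[OF t, of S] this]
    have "(\<lambda>k. S * t k + (w k * t k - w (Suc k) * t (Suc k))) sums (S * \<beta> n)" by simp
    moreover have "((1 - c) / (1 - b) * ((1 - b * q powi j k) / (1 - c * q powi (2 * j k)) * \<alpha> (j k)
       - q powi (j k - 1) * (c * q powi (j k - 1) - b) / (1 - c * q powi (2 * (j k - 1))) * \<alpha> (j k - 1)))
       / (qpoch q q (n - j k) * qpoch q (c * q powi (-1) * q) (n + j k))
       = S * t k + (w k * t k - w (Suc k) * t (Suc k))" for k
    proof -
      define Q where "Q = qpoch q q (int k)"
      define Z where "Z = P (2 * n - int k + 1)"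
      define x where "x = q powi j k"
      define x' where "x' = q powi (j k - 1)"
      define y where "y = q ^ k"
      define d where "d = 1 - c * q powi (2 * j k)"
      define d' where "d' = 1 - c * q powi (2 * (j k - 1))"
      define r where "r = 1 - q ^ Suc k"
      have Q: "Q \<noteq> 0" "qpoch q q (int (Suc k)) = r * Q" and r: "r \<noteq> 0"
        using qpoch_q_rec[OF q, of "int k"] unfolding Q_def r_def
        by (simp_all add: add.commute flip: power_int_of_nat)
      have n: "q powi n = x * y"
        using q unfolding x_def y_def j_def by (simp flip: power_int_of_nat power_int_add)
      have xx: "q powi (2 * j k) = x * x"
        using q unfolding x_def by (simp flip: power_int_add)
      have xxy: "q powi (2 * n - int k) = x * x * y"
        using q unfolding x_def y_def j_def by (simp flip: power_int_of_nat power_int_add)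
      have d: "d \<noteq> 0" "d' \<noteq> 0" "d = 1 - c * (x * x)" "P 1 \<noteq> 0" "Z \<noteq> 0" "1 - b \<noteq> 0" "1 - c \<noteq> 0"
        using cnz[of 0] cnz[of "2 * j k"] cnz[of "2 * (j k - 1)"] P_nz b unfolding d_def d'_def Z_def xx by simp_all
      have P0: "P 0 = (1 - c) * P 1" using P_rec[of 0] by simp
      have P2: "P (2 * n - int k) = (1 - c * (x * x * y)) * Z"
        using P_rec[of "2 * n - int k"] by (simp add: Z_def xxy)
      have tk: "t k = \<alpha> (j k) * Z / (Q * P 1)" by (simp add: t_def Q_def Z_def)
      have "2 * n - int (Suc k) + 1 = 2 * n - int k" "j (Suc k) = j k - 1" by (auto simp: j_def)
      hence tk': "t (Suc k) = \<alpha> (j k - 1) * P (2 * n - int k) / (r * Q * P 1)"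
        and wk': "w (Suc k) = r * (x' * (c * x' - b)) / ((1 - b) * d')"
        unfolding t_def w_def Q(2) by (simp_all add: x'_def d'_def r_def)
      have wk: "w k = (1 - y) * (x * (c * x - b)) / ((1 - b) * d)"
        unfolding w_def by (simp add: y_def x_def d_def)
      \<comment> \<open>Here \<open>1 - c * (x * x * y)\<close> arises from replacing
        \<open>(cq)_(n+j)\<close> by \<open>(c)_(n+j)\<close>. The identity splits the numerator
        into a multiple of \<open>1 - b * q powi n\<close>, which is independent of \<open>k\<close>
        up to the cancelling \<open>d\<close>, and a part vanishing at \<open>y = 1\<close>.\<close>
      have "(1 - b * x) * (1 - c * (x * x * y)) = (1 - b * (x * y)) * d + (1 - y) * (x * (c * x - b))"
        unfolding d by (simp add: algebra_simps)
      hence "(1 - b * x) * (1 - c * (x * x * y)) / ((1 - b) * d) = S + w k"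
        using d(1,6) unfolding S_def wk n by (simp add: add_divide_distrib)
      hence 1: "(1 - b * x) * (1 - c * (x * x * y)) / ((1 - b) * d) * t k = S * t k + w k * t k"
        by (simp add: ring_distribs)
      have 2: "w (Suc k) * t (Suc k) =
         (x' * (c * x' - b)) / ((1 - b) * d') * (\<alpha> (j k - 1) * P (2 * n - int k) / (Q * P 1))"
        unfolding wk' tk' using r by (simp add: mult_ac)
      \<comment> \<open>Stated over fresh variables, so that \<open>field_simps\<close> sees a
        purely rational identity; \<open>v\<close> is the factor relating
        \<open>P (2 * n - int k)\<close> to \<open>Z\<close>.\<close>
      have gen: "u * v / (b1 * d) * (A * Z / (Q * p)) - X / (b1 * d') * (A' * (v * Z) / (Q * p)) =
          (c1 / b1 * (u / d * A - X / d' * A')) / (Q * (c1 * p / (v * Z)))"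
        if "c1 \<noteq> 0" "b1 \<noteq> 0" "d \<noteq> 0" "d' \<noteq> 0" "v \<noteq> 0" "Q \<noteq> 0" "p \<noteq> 0" "Z \<noteq> 0"
        for u v b1 c1 d d' A A' Z Q p X :: complex
        using that by (simp add: field_simps)
      have nj: "n - j k = int k" "n + j k = 2 * n - int k" by (simp_all add: j_def)
      have "S * t k + (w k * t k - w (Suc k) * t (Suc k)) =
         (1 - b * x) * (1 - c * (x * x * y)) / ((1 - b) * d) * (\<alpha> (j k) * Z / (Q * P 1)) -
         (x' * (c * x' - b)) / ((1 - b) * d') * (\<alpha> (j k - 1) * P (2 * n - int k) / (Q * P 1))"
        using 1 2 tk by simp
      also have "\<dots> = ((1 - c) / (1 - b) * ((1 - b * x) / d * \<alpha> (j k) - x' * (c * x' - b) / d' * \<alpha> (j k - 1)))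
         / (Q * (P 0 / P (2 * n - int k)))"
        unfolding P0 P2 by (rule gen) (use d Q(1) P_nz[of "2 * n - int k"] P2 in auto)
      finally show ?thesis
        unfolding nj qpoch_c by (simp add: x_def x'_def d_def d'_def Q_def)
    qed
    ultimately show "(\<lambda>k. let i = n - int k in
        ((1 - c) / (1 - b) * ((1 - b * q powi i) / (1 - c * q powi (2 * i)) * \<alpha> i
       - q powi (i - 1) * (c * q powi (i - 1) - b) / (1 - c * q powi (2 * (i - 1))) * \<alpha> (i - 1)))
       / (qpoch q q (n - i) * qpoch q (c * q powi (-1) * q) (n + i)))
       sums ((1 - b * q powi n) / (1 - b) * \<beta> n)"
      unfolding Let_def j_def S_def by simp
  qed
qed

section \<open>Finite sums for f and its recurrence in N\<close>

text \<open>The sums over \<open>M\<close>, \<open>u\<close> and \<open>j\<close> are all reduced to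
  the range \<open>0..N\<close> by this one lemma.\<close>

lemma infsum_int_eq_sum:
  fixes f :: "int \<Rightarrow> complex"
  assumes "\<And>i. i < 0 \<or> i > int N \<Longrightarrow> f i = 0"
  shows "infsum f UNIV = (\<Sum>k\<le>N. f (int k))"
proof -
  have "i \<in> int ` {..N}" if "\<not> (i < 0 \<or> i > int N)" for i
    using that by (intro image_eqI[of _ _ "nat i"]) auto
  hence "infsum f UNIV = infsum f (int ` {..N})"
    using assms by (intro infsum_cong_neutral) auto
  thus ?thesis by (simp add: sum.reindex)
qed

text \<open>The coefficient of \<open>(-1) ^ M * elem_sym N M b\<close> in f, for
  \<open>M \<ge> 0\<close>; the index \<open>k\<close> is \<open>u\<close>.\<close>

definition gsum :: "complex \<Rightarrow> complex \<Rightarrow> nat \<Rightarrow> int \<Rightarrow> int \<Rightarrow> int \<Rightarrow> complex" where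
  "gsum q a N M j n = (\<Sum>k\<le>N. a ^ k * gterm q n M (int N - M) (j - int k) (int k))"

lemma gterm_eq_0: "v < 0 \<or> v > M \<or> u < 0 \<or> u > K \<Longrightarrow> gterm q n M K v u = 0"
  by (auto simp: gterm_def qbinom_eq_0)

lemma gsum_eq_0: "j < 0 \<or> j > int N \<Longrightarrow> gsum q a N M j n = 0"
proof -
  assume j: "j < 0 \<or> j > int N"
  have "gterm q n M (int N - M) (j - int k) (int k) = 0" if "k \<le> N" for k
    by (rule gterm_eq_0) (use j that in linarith)
  thus ?thesis by (simp add: gsum_def)
qed

lemma bailey_f_eq:
  "bailey_f q a b N j n = (\<Sum>m\<le>N. (-1) ^ m * elem_sym N (int m) b * gsum q a N (int m) j n)"
proof -
  define T where "T M = (\<Sum>\<^sub>\<infinity>u::int. a powi u * q powi ((M - j + u) * (n - j + u) + u * (n - int N))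
        * qbinom q M (j - u) * qbinom q (int N - M) u * (-1) powi M * elem_sym N M b)" for M
  \<comment> \<open>\<open>M \<ge> 0\<close> ensures \<open>u \<le> N - M \<le> N\<close> on the
    support. Negative \<open>M\<close> are discarded through the vanishing of
    \<open>elem_sym\<close>.\<close>
  have inner: "T M = (-1) powi M * elem_sym N M b * gsum q a N M j n" if "M \<ge> 0" for M
    unfolding T_def
  proof (subst infsum_int_eq_sum[of N])
    show "(\<Sum>k\<le>N. a powi int k * q powi ((M - j + int k) * (n - j + int k) + int k * (n - int N))
        * qbinom q M (j - int k) * qbinom q (int N - M) (int k) * (-1) powi M * elem_sym N M b)
      = (-1) powi M * elem_sym N M b * gsum q a N M j n"
      unfolding gsum_def gterm_def sum_distrib_left
      by (intro sum.cong) (simp_all add: algebra_simps)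
  qed (use that in \<open>auto simp: qbinom_eq_0\<close>)
  have "bailey_f q a b N j n = infsum T UNIV"
    by (simp only: bailey_f_def T_def[abs_def])
  also have "\<dots> = (\<Sum>m\<le>N. T (int m))"
    by (rule infsum_int_eq_sum) (simp add: T_def elem_sym_eq_0)
  finally show ?thesis by (simp add: inner)
qed

lemma bailey_f_eq_0: "j < 0 \<or> j > int N \<Longrightarrow> bailey_f q a b N j n = 0"
  by (simp add: bailey_f_eq gsum_eq_0)

lemma gsum_extend:
  assumes "M \<ge> 0"
  shows "gsum q a N M j n = (\<Sum>k\<le>Suc N. a ^ k * gterm q n M (int N - M) (j - int k) (int k))"
  using assms unfolding gsum_def by (simp add: gterm_eq_0)

text \<open>Reindexing by \<open>u = k - 1\<close> lets \<open>a ^ k\<close> absorb the factor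
  \<open>a\<close> and restores \<open>v = j - k\<close>, as in the unshifted sums; the new term
  \<open>k = 0\<close> has \<open>u = -1\<close> and vanishes.\<close>

lemma gsum_shift:
  "a * gsum q a N M (j - 1) n =
    (\<Sum>k\<le>Suc N. a ^ k * gterm q n M (int N - M) (j - int k) (int k - 1))"
  unfolding gsum_def sum.atMost_Suc_shift sum_distrib_left
  by (simp add: gterm_eq_0 algebra_simps del: sum.atMost_Suc)

text \<open>\<open>N\<close> grows with \<open>M\<close> fixed, so \<open>K = N - M\<close> grows by
  one. This half handles the index sets that avoid \<open>Suc N\<close>.\<close>

lemma gsum_rec_A:
  assumes q: "norm q < 1" "q \<noteq> 0" and M: "0 \<le> M" "M \<le> int N"
  shows "(1 - a * q powi (2 * n - int N - 1)) * gsum q a (Suc N) M j n =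
    (1 - a * q powi (2 * n - int N - 1 - j)) * gsum q a N M j n +
    a * q powi (n - 1 - int N) * (1 - a * q powi (2 * n - j)) * gsum q a N M (j - 1) (n - 1)"
proof -
  define K where "K = int N - M"
  have K: "K \<ge> 0" "int (Suc N) - M = K + 1" "int N = M + K" using M by (auto simp: K_def)
  define g where "g k = gterm q n M (K + 1) (j - int k) (int k)" for k
  define g' where "g' k = gterm q n M K (j - int k) (int k)" for k
  define g'' where "g'' k = gterm q (n - 1) M K (j - int k) (int k - 1)" for k
  define h where "h k = a ^ k * shiftA q n M K (j - int k) (int k)" for k
  define A1 where "A1 = q powi (2 * n - M - K - 1)"
  define A2 where "A2 = q powi (2 * n - M - K - 1 - j)"
  define A3 where "A3 = q powi (n - 1 - M - K)"
  define A4 where "A4 = q powi (2 * n - j)"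
  have A34: "q powi (3 * n - 1 - M - K - j) = A3 * A4"
    using q unfolding A3_def A4_def by (simp add: algebra_simps flip: power_int_add)
  have 1: "g k - g' k - A3 * g'' k = shiftA q n M K (j - int k) (int k)" for k
    unfolding g_def g'_def g''_def A3_def by (rule gterm_rec_A1[OF q K(1)])
  have 2: "A1 * g k - A2 * g' k - A3 * A4 * g'' k
      = shiftA q n M K (j - int (Suc k)) (int (Suc k))" for k
    using gterm_rec_A2[OF q K(1), of n M "j - int k" "int k"]
    unfolding g_def g'_def g''_def A1_def A2_def A34[symmetric] by (simp add: algebra_simps)
  \<comment> \<open>The part free of \<open>a\<close> gives \<open>h k\<close>. The coefficient of
    \<open>-a\<close> gives \<open>shiftA\<close> at \<open>(v - 1, u + 1)\<close>, and
    \<open>a * a ^ k = a ^ Suc k\<close> turns it into \<open>h (Suc k)\<close>.\<close>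
  have *: "a ^ k * ((1 - a * A1) * g k - (1 - a * A2) * g' k - A3 * (1 - a * A4) * g'' k) = h k - h (Suc k)" for k
    unfolding h_def 2[symmetric] unfolding 1[symmetric] by (simp add: algebra_simps)
  have "(1 - a * A1) * gsum q a (Suc N) M j n - (1 - a * A2) * gsum q a N M j n
      - A3 * (1 - a * A4) * (a * gsum q a N M (j - 1) (n - 1)) =
      (\<Sum>k\<le>Suc N. a ^ k * ((1 - a * A1) * g k - (1 - a * A2) * g' k - A3 * (1 - a * A4) * g'' k))"
    unfolding gsum_shift unfolding gsum_extend[OF M(1), of q a N] K_def[symmetric]
      gsum_def[of q a "Suc N"] K(2) g_def g'_def g''_def
      sum_distrib_left sum_subtractf[symmetric]
    by (intro sum.cong refl) (simp add: algebra_simps)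
  also have "\<dots> = h 0 - h (Suc (Suc N))"
    unfolding * by (rule sum_telescope)
  \<comment> \<open>Both ends vanish: the binomials there are \<open>qbinom q K (-1)\<close> and
    \<open>qbinom q K (N + 1)\<close> with \<open>K \<le> N\<close>.\<close>
  also have "\<dots> = 0"
    using M by (simp add: h_def shiftA_def qbinom_eq_0 q K_def)
  finally show ?thesis
    unfolding A1_def A2_def A3_def A4_def K(3) by (simp add: algebra_simps)
qed

text \<open>\<open>N\<close> and \<open>M\<close> grow together, so \<open>K\<close> is fixed. This
  half handles the index sets that contain \<open>Suc N\<close>.\<close>

lemma gsum_rec_B:
  assumes q: "norm q < 1" "q \<noteq> 0" and M: "0 \<le> M" "M \<le> int N"
  shows "(1 - a * q powi (2 * n - int N - 1)) * gsum q a (Suc N) (M + 1) j n =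
    q powi n * (1 - a * q powi (2 * n - int N - 1 - j)) * gsum q a N M j n +
    (1 - a * q powi (2 * n - j)) * gsum q a N M (j - 1) (n - 1)"
proof -
  define K where "K = int N - M"
  have K: "K \<ge> 0" "int (Suc N) - (M + 1) = K" "int N = M + K" using M by (auto simp: K_def)
  define g where "g k = gterm q n (M + 1) K (j - int k) (int k)" for k
  define g' where "g' k = gterm q n M K (j - int k) (int k)" for k
  define g'' where "g'' k = gterm q (n - 1) M K (j - 1 - int k) (int k)" for k
  define h where "h k = a ^ k * shiftB q n M K (j - int k) (int k)" for k
  define A1 where "A1 = q powi (2 * n - M - K - 1)"
  define A2 where "A2 = q powi (2 * n - M - K - 1 - j)"
  define A3 where "A3 = q powi n"
  define A4 where "A4 = q powi (2 * n - j)"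
  have A23: "q powi (3 * n - M - K - 1 - j) = A3 * A2"
    using q unfolding A3_def A2_def by (simp add: algebra_simps flip: power_int_add)
  have 1: "g k - A3 * g' k - g'' k = shiftB q n M K (j - int k) (int k)" for k
    using gterm_rec_B1[OF q M(1), of n K "j - int k" "int k"]
    unfolding g_def g'_def g''_def A3_def by (simp add: algebra_simps)
  have 2: "A1 * g k - A3 * A2 * g' k - A4 * g'' k
      = shiftB q n M K (j - int (Suc k)) (int (Suc k))" for k
    using gterm_rec_B2[OF q M(1), of n K "j - int k" "int k"]
    unfolding g_def g'_def g''_def A1_def A4_def A23[symmetric] by (simp add: algebra_simps)
  have *: "a ^ k * ((1 - a * A1) * g k - A3 * (1 - a * A2) * g' k - (1 - a * A4) * g'' k) = h k - h (Suc k)" for k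
    unfolding h_def 2[symmetric] unfolding 1[symmetric] by (simp add: algebra_simps)
  have "(1 - a * A1) * gsum q a (Suc N) (M + 1) j n - A3 * (1 - a * A2) * gsum q a N M j n
      - (1 - a * A4) * gsum q a N M (j - 1) (n - 1) =
      (\<Sum>k\<le>Suc N. a ^ k * ((1 - a * A1) * g k - A3 * (1 - a * A2) * g' k - (1 - a * A4) * g'' k))"
    unfolding gsum_extend[OF M(1), of q a N] K_def[symmetric]
      gsum_def[of q a "Suc N"] K(2) g_def g'_def g''_def
      sum_distrib_left sum_subtractf[symmetric]
    by (intro sum.cong refl) (simp add: algebra_simps)
  also have "\<dots> = h 0 - h (Suc (Suc N))"
    unfolding * by (rule sum_telescope)
  \<comment> \<open>The lower end vanishes by the factor \<open>1 - q powi u\<close> at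
    \<open>u = 0\<close>, the upper one by \<open>qbinom q K (N + 2) = 0\<close>.\<close>
  also have "\<dots> = 0"
    using M by (simp add: h_def shiftB_def qbinom_eq_0 q K_def)
  finally show ?thesis
    unfolding A1_def A2_def A3_def A4_def K(3) by (simp add: algebra_simps)
qed

text \<open>By \<open>elem_sym_Suc\<close>, the coefficient of \<open>e m\<close> in the new f is
  \<open>G m - b (Suc N) * G (Suc m)\<close>. The right sides of \<open>gsum_rec_A\<close> and
  \<open>gsum_rec_B\<close> involve the same two sums, so they combine into the factors
  \<open>1 - b q^n\<close> and \<open>a q^(n-1-N) - b\<close>.\<close>

lemma bailey_f_rec:
  assumes q: "norm q < 1" "q \<noteq> 0"
  shows "(1 - a * q powi (2 * n - int N - 1)) * bailey_f q a b (Suc N) j n =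
    (1 - b (Suc N) * q powi n) * (1 - a * q powi (2 * n - int N - 1 - j)) * bailey_f q a b N j n +
    (a * q powi (n - 1 - int N) - b (Suc N)) * (1 - a * q powi (2 * n - j)) *
      bailey_f q a b N (j - 1) (n - 1)"
proof -
  define A where "A = 1 - a * q powi (2 * n - int N - 1)"
  define e where "e m = (-1) ^ m * elem_sym N (int m) b" for m
  define G where "G m = gsum q a (Suc N) (int m) j n" for m
  have "bailey_f q a b (Suc N) j n =
      (\<Sum>m\<le>Suc N. e m * G m) + b (Suc N) * (\<Sum>m\<le>Suc N. (-1) ^ m * elem_sym N (int m - 1) b * G m)"
    unfolding bailey_f_eq elem_sym_Suc e_def G_def sum_distrib_left sum.distrib[symmetric]
    by (intro sum.cong refl) (simp add: algebra_simps)
  also have "(\<Sum>m\<le>Suc N. e m * G m) = (\<Sum>m\<le>N. e m * G m)"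
    by (simp add: e_def elem_sym_eq_0)
  also have "(\<Sum>m\<le>Suc N. (-1) ^ m * elem_sym N (int m - 1) b * G m) = (\<Sum>m\<le>N. - (e m * G (Suc m)))"
    unfolding sum.atMost_Suc_shift e_def by (simp add: elem_sym_eq_0)
  finally have f: "bailey_f q a b (Suc N) j n =
      (\<Sum>m\<le>N. e m * G m) + b (Suc N) * (\<Sum>m\<le>N. - (e m * G (Suc m)))" .
  have "A * bailey_f q a b (Suc N) j n =
      (\<Sum>m\<le>N. e m * (A * G m - b (Suc N) * (A * G (Suc m))))"
    unfolding f distrib_left sum_distrib_left sum.distrib[symmetric]
    by (intro sum.cong refl) (simp add: algebra_simps)
  also have "\<dots> = (\<Sum>m\<le>N. (1 - b (Suc N) * q powi n) * (1 - a * q powi (2 * n - int N - 1 - j)) *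
        (e m * gsum q a N (int m) j n) +
      (a * q powi (n - 1 - int N) - b (Suc N)) * (1 - a * q powi (2 * n - j)) *
        (e m * gsum q a N (int m) (j - 1) (n - 1)))"
  proof (intro sum.cong refl, goal_cases)
    case (1 m)
    have m: "0 \<le> int m" "int m \<le> int N" using 1 by auto
    have s: "int (Suc m) = int m + 1" by simp
    show ?case
      unfolding G_def s A_def gsum_rec_A[OF q m] gsum_rec_B[OF q m]
      by (simp only: ring_distribs mult_ac) simp
  qed
  finally show ?thesis
    unfolding A_def bailey_f_eq e_def by (simp add: sum.distrib sum_distrib_left)
qed

section \<open>The iterated step yields the stated formula for the new sequence\<close>

definition bailey_coeff ::
    "complex \<Rightarrow> complex \<Rightarrow> (nat \<Rightarrow> complex) \<Rightarrow> nat \<Rightarrow> int \<Rightarrow> int \<Rightarrow> complex" where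
  "bailey_coeff q a b N j n = (-1) powi j
     * (q powi (j * n - (j * (j + 1)) div 2) * bailey_f q a b N j n
        / qpoch q (a * q powi (2 * n - int N - j)) (int N + 1))"

lemma bailey_alpha_eq:
  "bailey_alpha q a b \<alpha> N n =
     (1 - a * q powi (2 * n - int N)) * qpoch q (a * q powi (1 - int N)) (int N) / (\<Prod>i=1..N. 1 - b i)
     * (\<Sum>k\<le>N. bailey_coeff q a b N (int k) n * \<alpha> (n - int k))"
  unfolding bailey_alpha_def
  by (subst infsum_int_eq_sum[of N]) (simp_all add: bailey_f_eq_0 bailey_coeff_def mult.assoc)

lemma bailey_coeff_eq_0: "j < 0 \<or> j > int N \<Longrightarrow> bailey_coeff q a b N j n = 0"
  by (simp add: bailey_coeff_def bailey_f_eq_0)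

text \<open>The factors \<open>x\<close> and \<open>y\<close> are the first and last of the
  \<open>N + 2\<close> factors in the new denominator. Dropping the first gives the old denominator
  at \<open>(j, n)\<close>, dropping the last the one at \<open>(j - 1, n - 1)\<close>; hence the
  recurrence of f, divided by the full product, is this one.\<close>

lemma bailey_coeff_rec:
  assumes q: "norm q < 1" "q \<noteq> 0" and a: "\<And>k::int. a * q powi k \<noteq> 1"
  shows "(1 - a * q powi (2 * n - int N - 1)) * bailey_coeff q a b (Suc N) j n =
    (1 - b (Suc N) * q powi n) * bailey_coeff q a b N j n -
    q powi (n - 1) * (a * q powi (n - 1 - int N) - b (Suc N)) * bailey_coeff q a b N (j - 1) (n - 1)"
proof -
  define P where "P m = qpoch_inf q (a * q powi m)" for m
  note P_nz = qpoch_inf_powi_nonzero[OF q a, folded P_def]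
  note P_rec = qpoch_inf_powi_rec[OF q a, folded P_def]
  have qpoch_a: "qpoch q (a * q powi m) k = P m / P (m + k)" for m k
    using q by (simp add: qpoch_def P_def power_int_add mult_ac)
  define s where "s = (-1) powi j * q powi (j * n - (j * (j + 1)) div 2)"
  define F where "F = bailey_f q a b N j n"
  define F' where "F' = bailey_f q a b N (j - 1) (n - 1)"
  define p where "p = P (2 * n - int N - j)"
  define r where "r = P (2 * n - j + 1)"
  define x where "x = 1 - a * q powi (2 * n - int N - 1 - j)"
  define y where "y = 1 - a * q powi (2 * n - j)"
  have p': "P (2 * n - int N - 1 - j) = x * p"
    using P_rec[of "2 * n - int N - 1 - j"] by (simp add: x_def p_def algebra_simps)
  have r': "P (2 * n - j) = y * r"
    using P_rec[of "2 * n - j"] by (simp add: y_def r_def)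
  have nz: "x \<noteq> 0" "y \<noteq> 0" "p \<noteq> 0" "r \<noteq> 0"
    using P_nz[of "2 * n - int N - 1 - j"] P_nz[of "2 * n - j"] p' r' by auto
  have "(2 * n - int (Suc N) - j) = 2 * n - int N - 1 - j"
    "2 * n - int N - 1 - j + (int (Suc N) + 1) = 2 * n - j + 1" by auto
  hence c1: "bailey_coeff q a b (Suc N) j n = s * bailey_f q a b (Suc N) j n * r / (x * p)"
    unfolding bailey_coeff_def qpoch_a by (simp only: p' r_def[symmetric]) (simp add: s_def)
  have "2 * n - int N - j + (int N + 1) = 2 * n - j + 1" by auto
  hence c2: "bailey_coeff q a b N j n = s * F * r / p"
    unfolding bailey_coeff_def qpoch_a by (simp only: r_def[symmetric] p_def[symmetric]) (simp add: s_def F_def)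
  have "2 * (n - 1) - int N - (j - 1) = 2 * n - int N - 1 - j"
    "2 * n - int N - 1 - j + (int N + 1) = 2 * n - j" by auto
  hence c3: "bailey_coeff q a b N (j - 1) (n - 1) = (-1) powi (j - 1) * q powi ((j - 1) * (n - 1) -
      ((j - 1) * (j - 1 + 1)) div 2) * F' * (y * r) / (x * p)"
    unfolding bailey_coeff_def qpoch_a by (simp only: p' r') (simp add: F'_def)
  \<comment> \<open>Consecutive triangular numbers differ by \<open>j\<close>, so the two exponents
    of \<open>q\<close> differ by \<open>n - 1\<close>. Writing the difference as
    \<open>j * 2\<close> splits \<open>div 2\<close> without a parity argument.\<close>
  have "j * (j + 1) = (j - 1) * (j - 1 + 1) + j * 2" by (simp add: algebra_simps)
  hence "(j * (j + 1)) div 2 = ((j - 1) * (j - 1 + 1)) div 2 + j" by simp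
  hence "q powi (n - 1) * q powi ((j - 1) * (n - 1) - ((j - 1) * (j - 1 + 1)) div 2) =
      q powi (j * n - (j * (j + 1)) div 2)"
    using q by (simp add: algebra_simps flip: power_int_add)
  moreover have "(-1) powi (j - 1) = - ((-1) powi j :: complex)"
    by (simp add: power_int_diff)
  ultimately have s: "q powi (n - 1) * ((-1) powi (j - 1) * q powi ((j - 1) * (n - 1) -
      ((j - 1) * (j - 1 + 1)) div 2)) = - s"
    unfolding s_def by simp
  define B where "B = a * q powi (n - 1 - int N) - b (Suc N)"
  have rec: "(1 - a * q powi (2 * n - int N - 1)) * bailey_f q a b (Suc N) j n =
      (1 - b (Suc N) * q powi n) * x * F + B * y * F'"
    unfolding F_def F'_def x_def y_def B_def by (rule bailey_f_rec[OF q])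
  have "q powi (n - 1) * B * bailey_coeff q a b N (j - 1) (n - 1) = - s * (B * F' * (y * r) / (x * p))"
    unfolding c3 s[symmetric] by (simp add: mult_ac)
  moreover have "(1 - a * q powi (2 * n - int N - 1)) * bailey_coeff q a b (Suc N) j n =
      s * ((1 - a * q powi (2 * n - int N - 1)) * bailey_f q a b (Suc N) j n) * r / (x * p)"
    unfolding c1 by simp
  moreover have "\<dots> = (1 - b (Suc N) * q powi n) * (s * F * r / p) + s * (B * F' * (y * r) / (x * p))"
    unfolding rec using nz by (simp add: field_simps)
  ultimately show ?thesis unfolding c2 B_def by simp
qed

text \<open>The prefactor of \<open>bailey_alpha\<close> at index \<open>m\<close> contains
  \<open>1 - c * q powi (2 * m)\<close>, which cancels the denominators produced by
  \<open>bailey_step\<close>. The remaining \<open>1 - c\<close> extends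
  \<open>(a q^(1-N))_N\<close> to \<open>(a q^(-N))_(N+1)\<close>.\<close>

lemma bailey_alpha_Suc:
  assumes q: "norm q < 1" "q \<noteq> 0" and a: "\<And>k::int. a * q powi k \<noteq> 1"
    and c: "c = a * q powi (- int N)"
  shows "bailey_alpha q a b \<alpha> (Suc N) n =
    (1 - c) / (1 - b (Suc N)) *
     ((1 - b (Suc N) * q powi n) / (1 - c * q powi (2 * n)) * bailey_alpha q a b \<alpha> N n
       - q powi (n - 1) * (c * q powi (n - 1) - b (Suc N)) / (1 - c * q powi (2 * (n - 1)))
         * bailey_alpha q a b \<alpha> N (n - 1))"
proof -
  define D where "D = qpoch q (a * q powi (1 - int N)) (int N) / (\<Prod>i=1..N. 1 - b i)"
  define S where "S n = (\<Sum>k\<le>N. bailey_coeff q a b N (int k) n * \<alpha> (n - int k))" for n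
  have cp: "c * q powi m = a * q powi (m - int N)" for m
    using q by (simp add: c power_int_minus power_int_diff field_simps)
  have nz: "1 - a * q powi m \<noteq> 0" for m using a[of m] by (metis right_minus_eq)
  have alpha: "bailey_alpha q a b \<alpha> N m = (1 - c * q powi (2 * m)) * (D * S m)" for m
    unfolding bailey_alpha_eq cp D_def S_def by simp
  have poch: "qpoch q (a * q powi (1 - int (Suc N))) (int (Suc N)) =
      (1 - c) * qpoch q (a * q powi (1 - int N)) (int N)"
  proof -
    have e0: "1 - int (Suc N) = - int N" by simp
    have e1: "a * q powi (1 - int N) = a * q powi (- int N) * q"
      using q by (simp add: power_int_diff power_int_minus field_simps)
    have e2: "a * q powi (- int N) * q powi (int (Suc N)) = a * q powi (- int N) * q * q powi int N"
      using q by (simp add: power_int_add)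
    show ?thesis
      unfolding qpoch_def e0 e1 e2 c using qpoch_inf_rec[OF q(1) a, of "- int N"]
      by (simp only: times_divide_eq_right)
  qed
  have "(1 - a * q powi (2 * n - int N - 1)) *
      (\<Sum>k\<le>Suc N. bailey_coeff q a b (Suc N) (int k) n * \<alpha> (n - int k)) =
      (1 - b (Suc N) * q powi n) * (\<Sum>k\<le>Suc N. bailey_coeff q a b N (int k) n * \<alpha> (n - int k)) -
      q powi (n - 1) * (a * q powi (n - 1 - int N) - b (Suc N)) *
      (\<Sum>k\<le>Suc N. bailey_coeff q a b N (int k - 1) (n - 1) * \<alpha> (n - int k))"
    unfolding sum_distrib_left sum_subtractf[symmetric] mult.assoc[symmetric] bailey_coeff_rec[OF q a]
    by (intro sum.cong refl) (simp add: left_diff_distrib)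
  also have "(\<Sum>k\<le>Suc N. bailey_coeff q a b N (int k) n * \<alpha> (n - int k)) = S n"
    by (simp add: S_def bailey_coeff_eq_0)
  also have "(\<Sum>k\<le>Suc N. bailey_coeff q a b N (int k - 1) (n - 1) * \<alpha> (n - int k)) = S (n - 1)"
    unfolding sum.atMost_Suc_shift S_def by (simp add: bailey_coeff_eq_0 diff_diff_eq)
  finally have rec: "(1 - a * q powi (2 * n - int N - 1)) *
      (\<Sum>k\<le>Suc N. bailey_coeff q a b (Suc N) (int k) n * \<alpha> (n - int k)) =
      (1 - b (Suc N) * q powi n) * S n -
      q powi (n - 1) * (c * q powi (n - 1) - b (Suc N)) * S (n - 1)"
    unfolding cp .
  have idx: "2 * n - int (Suc N) = 2 * n - int N - 1" by simp
  have prods: "(\<Prod>i=1..Suc N. 1 - b i) = (\<Prod>i=1..N. 1 - b i) * (1 - b (Suc N))" by simp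
  have alpha_Suc: "bailey_alpha q a b \<alpha> (Suc N) n = (1 - c) / (1 - b (Suc N)) * D *
      ((1 - a * q powi (2 * n - int N - 1)) *
      (\<Sum>k\<le>Suc N. bailey_coeff q a b (Suc N) (int k) n * \<alpha> (n - int k)))"
    unfolding bailey_alpha_eq poch idx prods D_def
    by (simp only: times_divide_eq_left times_divide_eq_right mult_ac divide_divide_eq_left)
  have nz': "1 - c * q powi (2 * n) \<noteq> 0" "1 - c * q powi (2 * (n - 1)) \<noteq> 0"
    unfolding cp by (rule nz)+
  have gen: "E * D * (u * s - v * s') = E * (u / z * (z * (D * s)) - v / z' * (z' * (D * s')))"
    if "z \<noteq> 0" "z' \<noteq> 0" for E u v s s' z z' :: complex
    using that by (simp add: algebra_simps)
  show ?thesis unfolding alpha_Suc rec alpha by (rule gen[OF nz'])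
qed

text \<open>Only \<open>M = u = j = 0\<close> contributes, and \<open>1 - a * q powi (2 * n)\<close>
  cancels the single factor of the denominator.\<close>

lemma bailey_alpha_0:
  assumes q: "norm q < 1" "q \<noteq> 0" and a: "\<And>k::int. a * q powi k \<noteq> 1"
  shows "bailey_alpha q a b \<alpha> 0 n = \<alpha> n"
proof -
  note nz = qpoch_inf_powi_nonzero[OF q a]
  have "{I. I \<subseteq> {1..0::nat} \<and> int (card I) = 0} = {{}}" by auto
  hence es: "elem_sym 0 0 b = 1" unfolding elem_sym_def by (simp only:) simp
  have "bailey_f q a b 0 0 n = 1"
    by (simp add: bailey_f_eq gsum_def gterm_def qbinom_def qpoch_q_0[OF q] es)
  moreover have "qpoch q (a * q powi (2 * n)) 1 = 1 - a * q powi (2 * n)"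
    using qpoch_inf_rec[OF q(1) a, of "2 * n"] nz[of "2 * n + 1"] q
    by (simp add: qpoch_def power_int_add mult.assoc)
  moreover have "qpoch q (a * q) 0 = 1" using nz[of 1] by (simp add: qpoch_def)
  moreover have "1 - a * q powi (2 * n) \<noteq> 0" using a[of "2 * n"] by (metis right_minus_eq)
  ultimately show ?thesis by (simp add: bailey_alpha_eq bailey_coeff_def)
qed

theorem theorem1p16:
  fixes a q :: complex and \<alpha> \<beta> :: "int \<Rightarrow> complex" and b :: "nat \<Rightarrow> complex" and N :: nat
  assumes "q \<noteq> 0" and "norm q < 1"
    and "a \<noteq> 0" and "\<And>k::int. a * q powi k \<noteq> 1"
    and "\<And>i. i \<ge> 1 \<Longrightarrow> b i \<noteq> 1"
    and "bilateral_bailey_pair q a \<alpha> \<beta>"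
    and "N \<ge> 1"
  shows "bilateral_bailey_pair q (a * q powi (- int N))
           (bailey_alpha q a b \<alpha> N) (bailey_beta q b \<beta> N)"
proof -
  note q = assms(2,1)
  have "bilateral_bailey_pair q (a * q powi (- int m)) (bailey_alpha q a b \<alpha> m) (bailey_beta q b \<beta> m)" for m
  proof (induction m)
    case 0
    have "bailey_alpha q a b \<alpha> 0 = \<alpha>" "bailey_beta q b \<beta> 0 = \<beta>"
      using bailey_alpha_0[OF q assms(4)] by (auto simp: bailey_beta_def)
    thus ?case using assms(6) by simp
  next
    case (Suc m)
    \<comment> \<open>The genericity required by \<open>bailey_step\<close> is inherited from
      \<open>a\<close>, since \<open>c * q powi k\<close> is again \<open>a\<close> times an integer
      power of \<open>q\<close>.\<close>
    define c where "c = a * q powi (- int m)"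
    have "c * q powi k = a * q powi (k - int m)" for k
      using q by (simp add: c_def power_int_minus power_int_diff field_simps)
    hence "c * q powi k \<noteq> 1" for k using assms(4) by simp
    moreover have "c \<noteq> 0" using assms(1,3) by (simp add: c_def)
    moreover have "b (Suc m) \<noteq> 1" using assms(5) by simp
    moreover note Suc.IH[folded c_def]
    ultimately have "bilateral_bailey_pair q (c * q powi (-1)) (bailey_alpha q a b \<alpha> (Suc m))
        (\<lambda>n. (1 - b (Suc m) * q powi n) / (1 - b (Suc m)) * bailey_beta q b \<beta> m n)"
      using bailey_step[OF q, of c "b (Suc m)"]
      unfolding bailey_alpha_Suc[OF q assms(4) c_def, abs_def] by simp
    moreover have "c * q powi (-1) = a * q powi (- int (Suc m))"
    proof -
      have "- int (Suc m) = - int m + (-1)" by simp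
      thus ?thesis using q(2) power_int_add[of q "- int m" "-1"]
        by (simp only: c_def mult.assoc) simp
    qed
    moreover have "(\<lambda>n. (1 - b (Suc m) * q powi n) / (1 - b (Suc m)) * bailey_beta q b \<beta> m n) =
        bailey_beta q b \<beta> (Suc m)"
      by (simp add: fun_eq_iff bailey_beta_def)
    ultimately show ?case by simp
  qed
  thus ?thesis .
qed

end
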